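(* Let $k\geq 2$ and let $G$ be a (simple) graph of order $n\geq \frac{11}{2}k^2+2k-\frac{3}{2}$. If $e(G)>(k-\frac{3}{2})n$, then $G$ contains $k\cdot P_3$ as a subgraph unless one of the following holds: (i) $G\subseteq F_{n,k}$; (ii) $G\subseteq F_{n,k-1}(K_h)$ for some $h$ with $4\leq h\leq 5$; (iii) $G\subseteq F_{n,k-1}(N_6)$.
   Context: All graphs are finite and simple; $e(G)$ is the number of edges of $G$. $P_m$ is the path on $m$ vertices, $K_m$ the complete graph on $m$ vertices ($K_0$ and $K_s$ with $s=0$ denote the empty graph), and $k\cdot G$ is the disjoint union of $k$ copies of $G$. For disjoint graphs $G,H$, $G\cup H$ is their disjoint union and $G\nabla H$ is their join (the union together with all edges between $V(G)$ and $V(H)$). $G\subseteq H$ means $G$ is isomorphic to a subgraph of $H$. For a connected graph $H$ of order $h\ge 2$, an integer $k\ge 1$ and $n>k+h-1$, define $F_{n,k}(H)=K_{k-1}\nabla(H\cup p\cdot K_2\cup K_s)$, where $n-(k+h-1)=2p+s$ with $0\leq s<2$; write $F_{n,k}=F_{n,k}(K_2)$. $N_6$ is the graph on 6 vertices obtained from a triangle $K_3$ by attaching one pendant edge to each of its three vertices. *)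

theory Defs
  imports Complex_Main
begin

datatype 'a ugraph = UGraph (verts: "'a set") (edges: "'a set set")

definition simple_graph :: "'a ugraph \<Rightarrow> bool" where
  "simple_graph G \<longleftrightarrow>
     finite (verts G) \<and> (\<forall>e\<in>edges G. e \<subseteq> verts G \<and> card e = 2)"

definition subgraph :: "'a ugraph \<Rightarrow> 'a ugraph \<Rightarrow> bool" where
  "subgraph S H \<longleftrightarrow> simple_graph S \<and> verts S \<subseteq> verts H \<and> edges S \<subseteq> edges H"

definition graph_iso :: "'a ugraph \<Rightarrow> 'b ugraph \<Rightarrow> bool" where
  "graph_iso G H \<longleftrightarrow>
     (\<exists>f. bij_betw f (verts G) (verts H) \<and>
          (\<forall>u\<in>verts G. \<forall>v\<in>verts G. {u, v} \<in> edges G \<longleftrightarrow> {f u, f v} \<in> edges H))"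

definition contained_in :: "'a ugraph \<Rightarrow> 'b ugraph \<Rightarrow> bool"  (infix "\<sqsubseteq>\<^sub>g" 50) where
  "G \<sqsubseteq>\<^sub>g H \<longleftrightarrow> (\<exists>S. subgraph S H \<and> graph_iso G S)"

definition path_graph :: "nat \<Rightarrow> nat ugraph" where
  "path_graph m = UGraph {..<m} {{i, Suc i} |i. Suc i < m}"

definition complete_graph :: "nat \<Rightarrow> nat ugraph" where
  "complete_graph m = UGraph {..<m} {e. e \<subseteq> {..<m} \<and> card e = 2}"

definition disjoint_union :: "'a ugraph \<Rightarrow> 'b ugraph \<Rightarrow> ('a + 'b) ugraph" where
  "disjoint_union G H =
     UGraph (verts G <+> verts H) ((`) Inl ` edges G \<union> (`) Inr ` edges H)"

definition graph_join :: "'a ugraph \<Rightarrow> 'b ugraph \<Rightarrow> ('a + 'b) ugraph" where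
  "graph_join G H =
     UGraph (verts G <+> verts H)
       (edges (disjoint_union G H) \<union> {{Inl u, Inr v} |u v. u \<in> verts G \<and> v \<in> verts H})"

definition copies :: "nat \<Rightarrow> 'a ugraph \<Rightarrow> (nat \<times> 'a) ugraph" where
  "copies k G = UGraph ({..<k} \<times> verts G) {Pair i ` e |i e. i < k \<and> e \<in> edges G}"

text \<open>
  \<open>F_graph n k H\<close> is meaningful for \<open>k \<ge> 1\<close>, \<open>H\<close> connected of order \<open>h \<ge> 2\<close> and
  \<open>n > k + h - 1\<close>; \<open>p\<close> and \<open>s\<close> are the quotient and remainder of
  \<open>n - (k + h - 1)\<close> modulo 2.
\<close>

definition F_graph ::
    "nat \<Rightarrow> nat \<Rightarrow> 'a ugraph \<Rightarrow> (nat + (('a + nat \<times> nat) + nat)) ugraph" where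
  "F_graph n k H =
     (let r = n - (k + card (verts H) - 1); p = r div 2; s = r mod 2
      in graph_join (complete_graph (k - 1))
           (disjoint_union (disjoint_union H (copies p (complete_graph 2)))
              (complete_graph s)))"

definition N6 :: "nat ugraph" where
  "N6 = UGraph {..<6} {{0, 1}, {1, 2}, {0, 2}, {0, 3}, {1, 4}, {2, 5}}"

end

theory Submission
  imports Defs
begin

text \<open>
  If \<open>k \<ge> 3\<close> and \<open>G\<close> has no \<open>k\<close> disjoint copies of \<open>P\<^sub>3\<close>, a maximal packing covers at most
  \<open>3(k - 1)\<close> vertices and the edges avoiding it form a matching; the edge count therefore forces a
  vertex of degree at least \<open>3k - 1\<close>. Any packing of \<open>k - 1\<close> copies avoiding that vertex extends by
  a path centred at it, so deleting it reduces \<open>k\<close> by one. After \<open>k - 2\<close> deletions the remaining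
  graph has no two disjoint \<open>P\<^sub>3\<close>. Such a graph either has a vertex meeting every \<open>P\<^sub>3\<close>, or all
  its \<open>P\<^sub>3\<close>'s lie in a union of components of order 4 or 5, or in a component contained in \<open>N\<^sub>6\<close>;
  everything else is a matching.
\<close>

section \<open>Embeddings\<close>

text \<open>The witness is the image of \<open>G\<close> under \<open>f\<close>, carrying only the
  images of edges of \<open>G\<close>. Injectivity makes \<open>f\<close> reflect edges onto that
  image, so preserving edges is enough for an isomorphism.\<close>

lemma contained_inI:
  assumes G: "simple_graph G" and inj: "inj_on f (verts G)"
    and V: "f ` verts G \<subseteq> verts H"
    and E: "\<And>u v. {u, v} \<in> edges G \<Longrightarrow> {f u, f v} \<in> edges H"
  shows "G \<sqsubseteq>\<^sub>g H"
proof -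
  let ?S = "UGraph (f ` verts G) ((`) f ` edges G)"
  have sub: "e \<subseteq> verts G" and two: "card e = 2" if "e \<in> edges G" for e
    using G that by (auto simp: simple_graph_def)
  have "f ` e \<in> edges H" if e: "e \<in> edges G" for e
  proof -
    obtain u v where "e = {u, v}" using two[OF e] by (auto simp: card_2_iff)
    then show ?thesis using E e by auto
  qed
  moreover have "simple_graph ?S"
    using G inj two sub
    by (auto simp: simple_graph_def) (metis card_image inj_on_subset)
  ultimately have "subgraph ?S H"
    using V by (auto simp: subgraph_def)
  moreover have "graph_iso G ?S"
    unfolding graph_iso_def
  proof (intro exI[of _ f] conjI ballI)
    show "bij_betw f (verts G) (verts ?S)" using inj by (simp add: bij_betw_def)
    fix u v assume uv: "u \<in> verts G" "v \<in> verts G"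
    show "{u, v} \<in> edges G \<longleftrightarrow> {f u, f v} \<in> edges ?S"
    proof
      assume "{u, v} \<in> edges G"
      then have "f ` {u, v} \<in> (`) f ` edges G" by (rule imageI)
      then show "{f u, f v} \<in> edges ?S" by simp
    next
      assume "{f u, f v} \<in> edges ?S"
      then obtain e where e: "e \<in> edges G" "f ` {u, v} = f ` e" by auto
      then have "{u, v} = e"
        using inj_on_image_eq_iff[OF inj] sub uv by (metis empty_subsetI insert_subset)
      then show "{u, v} \<in> edges G" using e by simp
    qed
  qed
  ultimately show ?thesis unfolding contained_in_def by blast
qed

text \<open>Matched vertices receive the two numbers of one block 2q, 2q+1, so the blocks can become
  the copies of \<open>K_2\<close>. Induction removes a matched pair, numbers it 0 and 1, and shifts
  all other numbers by 2, which preserves blocks.\<close>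

lemma matching_enumeration:
  assumes "finite R"
    and "\<And>a b c. a \<in> R \<Longrightarrow> b \<in> R \<Longrightarrow> c \<in> R \<Longrightarrow> {a, b} \<in> E \<Longrightarrow> {b, c} \<in> E \<Longrightarrow> a = c"
  shows "\<exists>g. bij_betw g R {..<card R} \<and>
    (\<forall>u\<in>R. \<forall>v\<in>R. {u, v} \<in> E \<longrightarrow> g u div 2 = g v div (2::nat))"
  using assms
proof (induction R rule: finite_psubset_induct)
  case (psubset R)
  show ?case
  proof (cases "\<exists>u\<in>R. \<exists>v\<in>R. u \<noteq> v \<and> {u, v} \<in> E")
    case False
    obtain g where "bij_betw g R {0..<card R}"
      using ex_bij_betw_finite_nat[OF psubset.hyps(1)] by auto
    then show ?thesis using False by (intro exI[of _ g]) (auto simp: atLeast0LessThan)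
  next
    case True
    then obtain u v where uv: "u \<in> R" "v \<in> R" "u \<noteq> v" "{u, v} \<in> E" by auto
    define R' where "R' = R - {u, v}"
    have R': "R' \<subset> R" "R = insert u (insert v R')" "u \<notin> R'" "v \<notin> R'" "finite R'"
      using uv psubset.hyps(1) by (auto simp: R'_def)
    have "\<exists>g. bij_betw g R' {..<card R'} \<and>
        (\<forall>u\<in>R'. \<forall>v\<in>R'. {u, v} \<in> E \<longrightarrow> g u div 2 = g v div (2::nat))"
      using psubset.IH[OF R'(1)] psubset.prems R'(1) by (meson psubsetD)
    then obtain g where g: "bij_betw g R' {..<card R'}"
      and gE: "\<And>x y. x \<in> R' \<Longrightarrow> y \<in> R' \<Longrightarrow> {x, y} \<in> E \<Longrightarrow> g x div 2 = g y div 2" by auto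
    define h where "h x = (if x = u then 0 else if x = v then 1 else g x + 2)" for x
    have card: "card R = card R' + 2" using R' uv by simp
    have inj: "inj_on h R"
      using g R'(3,4) unfolding R'(2) by (auto simp: inj_on_def h_def bij_betw_def)
    have "h ` R \<subseteq> {..<card R}"
      using g unfolding card unfolding R'(2) by (auto simp: h_def bij_betw_def)
    then have "bij_betw h R {..<card R}"
      using inj by (simp add: bij_betw_def card_image card_subset_eq)
    moreover have "h x div 2 = h y div 2" if "x \<in> R" "y \<in> R" "{x, y} \<in> E" for x y
    proof -
      have vu: "{v, u} \<in> E" using uv by (simp add: insert_commute)
      have yx: "{y, x} \<in> E" using that by (simp add: insert_commute)
      \<comment> \<open>In a matching \<open>u\<close> and \<open>v\<close> have no partner but each
        other, so no edge of \<open>R\<close> joins the new block to the shifted part.\<close>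
      note P = psubset.prems
      have "x = u \<Longrightarrow> y = v" using P[OF that(2,1) uv(2) yx] uv by auto
      moreover have "x = v \<Longrightarrow> y = u" using P[OF that(2,1) uv(1) yx] vu by auto
      moreover have "y = u \<Longrightarrow> x = v" using P[OF that(1,2) uv(2)] that uv by auto
      moreover have "y = v \<Longrightarrow> x = u" using P[OF that(1,2) uv(1)] that vu by auto
      ultimately consider "x = u" "y = v" | "x = v" "y = u" | "x \<notin> {u, v}" "y \<notin> {u, v}" by blast
      then show ?thesis
      proof cases
        case 3
        then have "g x div 2 = g y div 2" using gE that by (auto simp: R'_def)
        then show ?thesis using 3 by (simp add: h_def)
      qed (auto simp: h_def)
    qed
    ultimately show ?thesis by blast
  qed
qed

text \<open>This is the common route to all three exceptional cases. \<open>S\<close> goes to the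
  clique joined to everything, \<open>C\<close> to \<open>H\<close>, and the rest, which spans a
  matching, fills the copies of \<open>K_2\<close> and possibly \<open>K_s\<close>.\<close>

lemma contained_in_F_graph:
  fixes G :: "'a ugraph" and H :: "'b ugraph"
  assumes G: "simple_graph G" and S: "S \<subseteq> verts G" and C: "C \<subseteq> verts G - S"
    and k: "k = card S + 1" and \<phi>: "bij_betw \<phi> C (verts H)"
    and hom: "\<And>u v. u \<in> C \<Longrightarrow> v \<in> C \<Longrightarrow> {u, v} \<in> edges G \<Longrightarrow> {\<phi> u, \<phi> v} \<in> edges H"
    and closed: "\<And>u w. u \<in> C \<Longrightarrow> {u, w} \<in> edges G \<Longrightarrow> w \<in> C \<union> S"
    and matching: "\<And>a b c. {a, b, c} \<inter> (S \<union> C) = {} \<Longrightarrow> {a, b} \<in> edges G \<Longrightarrow>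
      {b, c} \<in> edges G \<Longrightarrow> a = c"
  shows "G \<sqsubseteq>\<^sub>g F_graph (card (verts G)) k H"
proof -
  define R where "R = verts G - S - C"
  have fin: "finite (verts G)" "finite S" "finite C" "finite R"
    using G S C by (auto simp: simple_graph_def R_def intro: finite_subset)
  have V: "verts G = S \<union> C \<union> R" "S \<inter> C = {}" "S \<inter> R = {}" "C \<inter> R = {}"
    using S C by (auto simp: R_def)
  have cH: "card (verts H) = card C" using \<phi> bij_betw_same_card by fastforce
  have "card (verts G) = card S + card C + card R"
    using V fin by (simp add: card_Un_disjoint Int_Un_distrib2)
  then have r: "card (verts G) - (k + card (verts H) - 1) = card R"
    using cH k by simp
  obtain g where g: "bij_betw g R {..<card R}"
    and gE: "\<And>u v. u \<in> R \<Longrightarrow> v \<in> R \<Longrightarrow> {u, v} \<in> edges G \<Longrightarrow> g u div 2 = g v div 2"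
  proof -
    have "a = c" if "a \<in> R" "b \<in> R" "c \<in> R" "{a, b} \<in> edges G" "{b, c} \<in> edges G" for a b c
      by (rule matching[of a b c]) (use that in \<open>auto simp: R_def\<close>)
    then show ?thesis
      using matching_enumeration[OF fin(4), of "edges G"] that by blast
  qed
  obtain s where s: "bij_betw s S {..<card S}"
    using ex_bij_betw_finite_nat[OF fin(2)] by (auto simp: atLeast0LessThan)
  define p where "p = card R div 2"
  \<comment> \<open>On the matching part, the quotient of \<open>g x\<close> by 2 selects the copy
    of \<open>K_2\<close> and the remainder the end in it. Only the number 2p, present when
    \<open>card R\<close> is odd, falls through to \<open>K_s\<close>.\<close>
  define f :: "'a \<Rightarrow> nat + (('b + nat \<times> nat) + nat)" where
    "f x = (if x \<in> S then Inl (s x) else if x \<in> C then Inr (Inl (Inl (\<phi> x)))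
      else if g x < 2 * p then Inr (Inl (Inr (g x div 2, g x mod 2)))
      else Inr (Inr (g x - 2 * p)))" for x
  have fS: "x \<in> S \<Longrightarrow> f x = Inl (s x)" for x by (simp add: f_def)
  have fC: "x \<in> C \<Longrightarrow> f x = Inr (Inl (Inl (\<phi> x)))" for x using V by (auto simp: f_def)
  have fR: "x \<in> R \<Longrightarrow> f x = (if g x < 2 * p then Inr (Inl (Inr (g x div 2, g x mod 2)))
      else Inr (Inr (g x - 2 * p)))" for x using V by (auto simp: f_def)
  have sl: "x \<in> S \<Longrightarrow> s x < card S" for x using s by (auto simp: bij_betw_def)
  have gl: "x \<in> R \<Longrightarrow> g x < card R" for x using g by (auto simp: bij_betw_def)
  have \<phi>l: "x \<in> C \<Longrightarrow> \<phi> x \<in> verts H" for x using \<phi> by (auto simp: bij_betw_def)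
  have k1: "k - 1 = card S" using k by simp
  have FV: "verts (F_graph (card (verts G)) k H) =
    {..<card S} <+> ((verts H <+> ({..<p} \<times> {..<2})) <+> {..<card R mod 2})"
    unfolding F_graph_def r Let_def k1
    by (simp add: graph_join_def disjoint_union_def complete_graph_def copies_def p_def)
  have FE: "edges (F_graph (card (verts G)) k H) =
    (`) Inl ` {e. e \<subseteq> {..<card S} \<and> card e = 2} \<union>
    (`) Inr ` ((`) Inl ` ((`) Inl ` edges H \<union>
      (`) Inr ` {Pair i ` e |i e. i < p \<and> e \<subseteq> {..<2} \<and> card e = 2}) \<union>
      (`) Inr ` {e. e \<subseteq> {..<card R mod 2} \<and> card e = 2}) \<union>
    {{Inl u, Inr v} |u v. u < card S \<and>
       v \<in> (verts H <+> ({..<p} \<times> {..<2})) <+> {..<card R mod 2}}"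
    unfolding F_graph_def r Let_def k1
    by (simp add: graph_join_def disjoint_union_def complete_graph_def copies_def p_def)
  have fV: "f x \<in> verts (F_graph (card (verts G)) k H)" if "x \<in> verts G" for x
  proof -
    have "x \<in> R \<Longrightarrow> \<not> g x < 2 * p \<Longrightarrow> g x - 2 * p < card R mod 2"
      using gl[of x] unfolding p_def by presburger
    moreover have "g x < 2 * p \<Longrightarrow> g x div 2 < p" by presburger
    ultimately show ?thesis
      using that V(1) unfolding FV by (auto simp: fS fC fR sl \<phi>l)
  qed
  have "inj_on f (verts G)"
  proof (rule inj_onI)
    fix x y assume xy: "x \<in> verts G" "y \<in> verts G" "f x = f y"
    have 1: "x \<in> S \<Longrightarrow> y \<in> S \<Longrightarrow> x = y" using xy s by (auto simp: fS bij_betw_def inj_on_def)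
    have 2: "x \<in> C \<Longrightarrow> y \<in> C \<Longrightarrow> x = y" using xy \<phi> by (auto simp: fC bij_betw_def inj_on_def)
    have 3: "x = y" if R: "x \<in> R" "y \<in> R"
    proof -
      have "g x = g y"
        using xy(3) fR[OF R(1)] fR[OF R(2)]
        by (auto split: if_splits) (metis div_mult_mod_eq)
      then show ?thesis using g R by (auto simp: bij_betw_def inj_on_def)
    qed
    show "x = y" using 1 2 3 xy V(1) by (auto simp: fS fC fR split: if_splits)
  qed
  moreover have "{f u, f v} \<in> edges (F_graph (card (verts G)) k H)" if uv: "{u, v} \<in> edges G" for u v
  proof -
    let ?F = "edges (F_graph (card (verts G)) k H)"
    have uvV: "u \<in> verts G" "v \<in> verts G" "u \<noteq> v"
      using G uv by (auto simp: simple_graph_def)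
    have cross: "{f x, f y} \<in> ?F" if "x \<in> S" "y \<in> verts G" "y \<notin> S" for x y
    proof -
      have "\<exists>z. f y = Inr z" using that(3) by (simp add: f_def)
      then obtain z where z: "f y = Inr z" ..
      have "z \<in> (verts H <+> ({..<p} \<times> {..<2})) <+> {..<card R mod 2}"
        using fV[OF that(2)] unfolding FV z by auto
      then show ?thesis unfolding FE z fS[OF that(1)] using sl[OF that(1)] by blast
    qed
    consider "u \<in> S" "v \<in> S" | "u \<in> S" "v \<notin> S" | "u \<notin> S" "v \<in> S"
      | "u \<in> C" "v \<in> C" | "u \<in> R" "v \<in> R"
      using uvV V closed[of u v] closed[of v u] uv by (auto simp: insert_commute)
    then show ?thesis
    proof cases
      case 1
      have "s u \<noteq> s v" using s 1 uvV by (auto simp: bij_betw_def inj_on_def)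
      then have "{s u, s v} \<in> {e. e \<subseteq> {..<card S} \<and> card e = 2}" using sl 1 by auto
      then have "Inl ` {s u, s v} \<in> ?F" unfolding FE by blast
      then show ?thesis using 1 by (simp add: fS)
    next
      case 2 then show ?thesis using cross uvV by blast
    next
      case 3 then show ?thesis using cross[of v u] uvV by (simp add: insert_commute)
    next
      case 4
      have "Inr ` Inl ` Inl ` {\<phi> u, \<phi> v} \<in> ?F" unfolding FE using hom[OF 4 uv] by blast
      then show ?thesis using 4 by (simp add: fC)
    next
      case 5
      have d: "g u div 2 = g v div 2" using gE 5 uv by blast
      have ne: "g u \<noteq> g v" using g 5 uvV by (auto simp: bij_betw_def inj_on_def)
      have m: "g u mod 2 \<noteq> g v mod 2" using d ne by (metis div_mult_mod_eq)
      define q where "q = g u div 2"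
      have q: "g u = 2 * q + g u mod 2" "g v = 2 * q + g v mod 2"
        unfolding q_def by (simp, simp add: d)
      have b: "g u mod 2 < 2" "g v mod 2 < 2" by simp_all
      \<comment> \<open>The ends of the edge occupy both places of block \<open>q\<close>, so the
        block is full. Hence the leftover vertex in \<open>K_s\<close> is never an end of such an
        edge.\<close>
      have "2 * q + 1 < card R" using q b m gl[OF 5(1)] gl[OF 5(2)] by linarith
      then have qp: "q < p" unfolding p_def by linarith
      have l: "g u < 2 * p" "g v < 2 * p" using q b qp by linarith+
      have "{g u mod 2, g v mod 2} \<subseteq> {..<2} \<and> card {g u mod 2, g v mod 2} = 2" using m by auto
      moreover have "g u div 2 < p" using qp q_def by simp
      ultimately have "Pair (g u div 2) ` {g u mod 2, g v mod 2} \<in>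
          {Pair i ` e |i e. i < p \<and> e \<subseteq> {..<2} \<and> card e = 2}" by blast
      then have "Inr ` Inl ` Inr ` Pair (g u div 2) ` {g u mod 2, g v mod 2} \<in> ?F"
        unfolding FE
        by (rule UnI1[OF UnI2[OF imageI[OF UnI1[OF imageI[OF UnI2[OF imageI]]]]]])
      then show ?thesis using 5 l d by (simp add: fR)
    qed
  qed
  ultimately show ?thesis using contained_inI[OF G] fV by blast
qed

section \<open>Packings of paths on three vertices\<close>

text \<open>The last argument records the covered vertices, so that disjointness of a new path is a
  local condition. Working with an edge set turns deletion of vertices into filtering of
  edges.\<close>

inductive P3_packing :: "'a set set \<Rightarrow> nat \<Rightarrow> 'a set \<Rightarrow> bool" for E where
  empty: "P3_packing E 0 {}"
| add: "P3_packing E m U \<Longrightarrow> {a, b} \<in> E \<Longrightarrow> {b, c} \<in> E \<Longrightarrow> distinct [a, b, c] \<Longrightarrow>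
    {a, b, c} \<inter> U = {} \<Longrightarrow> P3_packing E (Suc m) ({a, b, c} \<union> U)"

lemma P3_packing_card: "P3_packing E m U \<Longrightarrow> finite U \<and> card U = 3 * m"
  by (induction rule: P3_packing.induct) auto

lemma P3_packing_mono: "P3_packing E m U \<Longrightarrow> E \<subseteq> E' \<Longrightarrow> P3_packing E' m U"
  by (induction rule: P3_packing.induct) (blast intro: P3_packing.intros)+

lemma P3_packing_subset: "P3_packing E m U \<Longrightarrow> U \<subseteq> \<Union> E"
  by (induction rule: P3_packing.induct) auto

lemma P3_packing_two:
  assumes "distinct [a, b, c, d, e, f]" "{a, b} \<in> E" "{b, c} \<in> E" "{d, e} \<in> E" "{e, f} \<in> E"
  shows "\<exists>U. P3_packing E 2 U"
proof -
  have "P3_packing E (Suc 0) ({a, b, c} \<union> {})"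
    by (rule P3_packing.add) (use assms in \<open>auto intro: P3_packing.empty\<close>)
  then have "P3_packing E (Suc (Suc 0)) ({d, e, f} \<union> ({a, b, c} \<union> {}))"
    by (rule P3_packing.add) (use assms in auto)
  then show ?thesis by (metis numeral_2_eq_2)
qed

text \<open>The label pairs are the vertices of \<open>copies m (path_graph 3)\<close>, so
  \<open>f\<close> is the embedding required by \<open>contained_inI\<close>.\<close>

lemma P3_packing_labelling:
  "P3_packing E m U \<Longrightarrow> \<exists>f. inj_on f ({..<m} \<times> {..<3::nat}) \<and> f ` ({..<m} \<times> {..<3}) \<subseteq> U \<and>
    (\<forall>i<m. {f (i, 0), f (i, 1)} \<in> E \<and> {f (i, 1), f (i, 2)} \<in> E)"
proof (induction rule: P3_packing.induct)
  case empty
  show ?case by auto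
next
  case (add m U a b c)
  then obtain f where f: "inj_on f ({..<m} \<times> {..<3::nat})" "f ` ({..<m} \<times> {..<3}) \<subseteq> U"
    "\<forall>i<m. {f (i, 0), f (i, 1)} \<in> E \<and> {f (i, 1), f (i, 2)} \<in> E" by blast
  define h where "h q = (if fst q < m then f q else [a, b, c] ! snd q)" for q
  have three: "{..<3::nat} = {0, 1, 2}" by auto
  have D: "{..<Suc m} \<times> {..<3} = {..<m} \<times> {..<3::nat} \<union> {(m, 0), (m, 1), (m, 2)}"
    unfolding three by (auto simp: less_Suc_eq)
  have h1: "h q = f q" if "q \<in> {..<m} \<times> {..<3}" for q using that by (auto simp: h_def)
  have h2: "h (m, 0) = a" "h (m, 1) = b" "h (m, 2) = c" by (auto simp: h_def)
  have "inj_on h ({..<m} \<times> {..<3})" using f(1) h1 by (metis (no_types, lifting) inj_on_cong)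
  moreover have "inj_on h {(m, 0), (m, 1), (m, 2)}" using add.hyps(4) h2 by (auto simp: inj_on_def)
  moreover have "h ` ({..<m} \<times> {..<3}) \<subseteq> U" using f(2) h1 by auto
  moreover have "h ` {(m, 0), (m, 1), (m, 2)} = {a, b, c}" using h2 by simp
  ultimately have "inj_on h ({..<Suc m} \<times> {..<3})" "h ` ({..<Suc m} \<times> {..<3}) \<subseteq> {a, b, c} \<union> U"
    unfolding D using add.hyps(5) by (auto simp: inj_on_Un image_Un)
  moreover have "\<forall>i<Suc m. {h (i, 0), h (i, 1)} \<in> E \<and> {h (i, 1), h (i, 2)} \<in> E"
    using f(3) h1 h2 add.hyps(2,3) by (auto simp: less_Suc_eq)
  ultimately show ?case by blast
qed

lemma P3_packing_contained_in:
  assumes G: "simple_graph G" and P: "P3_packing (edges G) k U"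
  shows "copies k (path_graph 3) \<sqsubseteq>\<^sub>g G"
proof -
  obtain f where f: "inj_on f ({..<k} \<times> {..<3::nat})" "f ` ({..<k} \<times> {..<3}) \<subseteq> U"
    "\<forall>i<k. {f (i, 0), f (i, 1)} \<in> edges G \<and> {f (i, 1), f (i, 2)} \<in> edges G"
    using P3_packing_labelling[OF P] by blast
  have "{{i, Suc i} |i. Suc i < 3} = {{0, 1}, {1, 2::nat}}"
    by (auto simp: less_Suc_eq numeral_3_eq_3)
  then have V: "verts (copies k (path_graph 3)) = {..<k} \<times> {..<3}"
    and E: "edges (copies k (path_graph 3)) = {Pair i ` e |i e. i < k \<and> e \<in> {{0, 1}, {1, 2}}}"
    by (auto simp: copies_def path_graph_def)
  have "simple_graph (copies k (path_graph 3))"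
    unfolding simple_graph_def V E by auto
  moreover have "f ` verts (copies k (path_graph 3)) \<subseteq> verts G"
    using f(2) P3_packing_subset[OF P] G unfolding V by (fastforce simp: simple_graph_def)
  moreover have "{f u, f v} \<in> edges G" if "{u, v} \<in> edges (copies k (path_graph 3))" for u v
    using that f(3) unfolding E by (auto simp: doubleton_eq_iff insert_commute)
  ultimately show ?thesis using contained_inI f(1) V by metis
qed

section \<open>Graphs without two disjoint paths on three vertices\<close>

locale two_P3_free =
  fixes A :: "'a \<Rightarrow> 'a \<Rightarrow> bool"
  assumes sym: "A x y \<Longrightarrow> A y x"
    and irr: "\<not> A x x"
    and no_two_P3: "distinct [a, b, c, d, e, f] \<Longrightarrow> A a b \<Longrightarrow> A b c \<Longrightarrow> A d e \<Longrightarrow> A e f \<Longrightarrow> False"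
begin

text \<open>A union of connected components, together with any isolated points.\<close>

definition closed :: "'a set \<Rightarrow> bool" where
  "closed C \<longleftrightarrow> (\<forall>x\<in>C. \<forall>y. A x y \<longrightarrow> y \<in> C)"

text \<open>The tree with centre \<open>v\<close> and legs of lengths 2, 2, 1; below,
  \<open>x\<close> and \<open>y\<close> are its knees, \<open>x'\<close> and \<open>y'\<close> its
  feet. It need not be induced: further edges may be present.\<close>

definition spider :: "'a \<Rightarrow> 'a \<Rightarrow> 'a \<Rightarrow> 'a \<Rightarrow> 'a \<Rightarrow> 'a \<Rightarrow> bool" where
  "spider v x x' y y' z \<longleftrightarrow>
     distinct [v, x, x', y, y', z] \<and> A v x \<and> A x x' \<and> A v y \<and> A y y' \<and> A v z"

lemma neq: "A x y \<Longrightarrow> x \<noteq> y"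
  using irr by blast

section \<open>Vertices of degree at least four\<close>

lemma matching_outside:
  assumes "A a b" "A b c" "a \<noteq> c" "{a, b, c} \<subseteq> C" "{d, e, f} \<inter> C = {}" "A d e" "A e f"
  shows "d = f"
proof (rule ccontr)
  assume "d \<noteq> f"
  then have "distinct [a, b, c, d, e, f]" using assms neq by auto
  then show False using no_two_P3 assms by blast
qed

text \<open>Two neighbours of \<open>v\<close> off the path would form a second, disjoint
  \<open>P_3\<close> with \<open>v\<close> in the middle.\<close>

lemma spared_neighbours:
  assumes P: "A a b" "A b c" "a \<noteq> c" "v \<notin> {a, b, c}" and D: "finite D" "D \<subseteq> {u. A v u}"
  shows "card (D - {a, b, c}) \<le> 1"
proof (rule ccontr)
  assume "\<not> ?thesis"
  then have "\<not> card (D - {a, b, c}) \<le> Suc 0" by simp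
  then obtain p q where pq: "p \<in> D - {a, b, c}" "q \<in> D - {a, b, c}" "p \<noteq> q"
    using card_le_Suc0_iff_eq[of "D - {a, b, c}"] D(1) by auto
  then have A: "A v p" "A v q" using D by auto
  have "distinct [a, b, c, p, v, q]" using pq P A neq by auto
  then show False using no_two_P3 P A sym by blast
qed

text \<open>A \<open>P_3\<close> avoiding \<open>v\<close> uses at most three neighbours of
  \<open>v\<close> and so spares two, against \<open>spared_neighbours\<close>.\<close>

lemma degree_ge_5:
  assumes "card {u. A v u} \<ge> 5" "A a b" "A b c" "a \<noteq> c"
  shows "v \<in> {a, b, c}"
proof (rule ccontr)
  assume "v \<notin> {a, b, c}"
  \<comment> \<open>An infinite set has \<open>card\<close> 0, so the degree bound already forces
    finiteness.\<close>
  moreover have fin: "finite {u. A v u}" using assms(1) by (intro card_ge_0_finite) simp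
  ultimately have "card ({u. A v u} - {a, b, c}) \<le> 1" using spared_neighbours assms by blast
  moreover have "card ({u. A v u} - {a, b, c}) \<ge> card {u. A v u} - card {a, b, c}"
    by (rule diff_card_le_card_Diff) simp
  moreover have "card {a, b, c} \<le> 3" by (simp add: card_insert_if)
  ultimately show False using assms(1) by linarith
qed

text \<open>At most one of the four neighbours is spared, so every \<open>P_3\<close> avoiding
  \<open>v\<close> lies inside the neighbourhood. Applied to a path that starts with an edge leaving
  the star, this shows that no such edge exists.\<close>

lemma degree_eq_4:
  assumes deg: "card {u. A v u} = 4" and P: "A a b" "A b c" "a \<noteq> c" "v \<notin> {a, b, c}"
  shows "closed (insert v {u. A v u})" "{a, b, c} \<subseteq> {u. A v u}"
proof -
  have fin: "finite {u. A v u}" using deg by (metis card.infinite zero_neq_numeral)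
  have in_N: "{p, q, r} \<subseteq> {u. A v u}" if "A p q" "A q r" "p \<noteq> r" "v \<notin> {p, q, r}" for p q r
  proof -
    have 3: "card {p, q, r} = 3" using that neq by auto
    have "card ({u. A v u} - {p, q, r}) \<le> 1" using spared_neighbours that fin by blast
    then have "card ({u. A v u} \<inter> {p, q, r}) \<ge> 3"
      using card_Diff_subset_Int[of "{u. A v u}" "{p, q, r}"] fin deg by simp
    then have "{u. A v u} \<inter> {p, q, r} = {p, q, r}"
      using 3 by (intro card_seteq) auto
    then show ?thesis by blast
  qed
  show abc: "{a, b, c} \<subseteq> {u. A v u}" using in_N P by blast
  show "closed (insert v {u. A v u})"
    unfolding closed_def
  proof (intro ballI allI impI)
    fix w y assume w: "w \<in> insert v {u. A v u}" and wy: "A w y"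
    show "y \<in> insert v {u. A v u}"
    proof (rule ccontr)
      assume y: "y \<notin> insert v {u. A v u}"
      then have vw: "A v w" and vy: "\<not> A v y" "y \<noteq> v" "w \<noteq> v" using w wy irr by auto
      have yabc: "y \<notin> {a, b, c}" using abc vy by auto
      \<comment> \<open>If \<open>w\<close> lies on the given path, then \<open>y\<close>,
        \<open>w\<close> and a neighbour of \<open>w\<close> on it form a \<open>P_3\<close>
        avoiding \<open>v\<close> but not inside the neighbourhood. Otherwise \<open>y\<close>,
        \<open>w\<close>, \<open>v\<close> is disjoint from \<open>a\<close>, \<open>b\<close>,
        \<open>c\<close>.\<close>
      consider "w = a" | "w = b" | "w = c" | "w \<notin> {a, b, c}" by blast
      then show False
      proof cases
        case 1 then show False using in_N[of y a b] wy sym P vy yabc by auto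
      next
        case 2 then show False using in_N[of y b c] wy sym P vy yabc by auto
      next
        case 3 then show False using in_N[of y c b] wy sym P vy yabc by auto
      next
        case 4
        have "distinct [a, b, c, y, w, v]" using 4 yabc P vy neq wy by auto
        then show False using no_two_P3 P wy vw sym by blast
      qed
    qed
  qed
qed

section \<open>Spiders\<close>

lemma spider_swap: "spider v x x' y y' z \<Longrightarrow> spider v y y' x x' z"
  by (auto simp: spider_def)

text \<open>Any other neighbour \<open>w\<close> gives the path \<open>x'\<close>, \<open>x\<close>,
  \<open>w\<close>. The rest of the spider still contains \<open>v\<close>, \<open>y\<close>,
  \<open>y'\<close> when \<open>w = z\<close>, and \<open>y\<close>, \<open>v\<close>,
  \<open>z\<close> otherwise.\<close>

lemma spider_knee:
  assumes s: "spider v x x' y y' z" and "A x w"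
  shows "w \<in> {v, x', y}"
proof (rule ccontr)
  assume w: "w \<notin> {v, x', y}"
  note S = s[unfolded spider_def]
  have E: "A x' x" "A y' y" "A y v" "A v y" "A v z" "A x w" "A w x" "A y y'"
    using S assms(2) sym by auto
  consider "w = z" | "w = y'" | "w \<notin> {x, y', z}" using assms(2) neq by auto
  then show False
  proof cases
    case 1
    then have "distinct [x', x, w, v, y, y']" using S by auto
    then show False using no_two_P3 E by blast
  next
    case 2
    then have "distinct [x', x, w, y, v, z]" using S by auto
    then show False using no_two_P3 E by blast
  next
    case 3
    then have "distinct [x', x, w, y, v, z]" using S w by auto
    then show False using no_two_P3 E by blast
  qed
qed

text \<open>The degree of \<open>v\<close> and \<open>spider_knee\<close> exclude \<open>v\<close>
  and \<open>y\<close> as neighbours of the foot. Any further \<open>w\<close> gives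
  \<open>x\<close>, \<open>x'\<close>, \<open>w\<close>, disjoint from \<open>v\<close>,
  \<open>y\<close>, \<open>y'\<close> when \<open>w = z\<close> and from \<open>y\<close>,
  \<open>v\<close>, \<open>z\<close> otherwise.\<close>

lemma spider_foot:
  assumes s: "spider v x x' y y' z" and v: "\<And>u. A v u \<Longrightarrow> u \<in> {x, y, z}" and "A x' w"
  shows "w = x"
proof (rule ccontr)
  assume w: "w \<noteq> x"
  note S = s[unfolded spider_def]
  have E: "A x x'" "A y v" "A v y" "A v z" "A x' w" "A y y'" "A w x'"
    using S assms(3) sym by auto
  have "w \<noteq> v" using v[of x'] S E by auto
  moreover have "w \<noteq> y" using spider_knee[OF spider_swap[OF s], of x'] S E by auto
  ultimately consider "w = z" | "w \<notin> {v, x, x', y, z}" using w E neq by auto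
  then show False
  proof cases
    case 1
    then have "distinct [x, x', w, v, y, y']" using S by auto
    then show False using no_two_P3 E by blast
  next
    case 2
    then have "distinct [x, x', w, y, v, z]" using S w by auto
    then show False using no_two_P3 E by blast
  qed
qed

text \<open>The alternative depends on whether the short leg can be extended. If not, the six
  vertices are closed and the only possible extra edge is between the knees, giving a subgraph of
  \<open>N_6\<close> with triangle \<open>v\<close>, \<open>x\<close>, \<open>y\<close>. If so, all
  three legs have length 2 and \<open>v\<close> meets every \<open>P_3\<close>.\<close>

lemma spider_structure:
  assumes s: "spider v x x' y y' z" and v: "\<And>u. A v u \<Longrightarrow> u \<in> {x, y, z}"
  shows "(\<forall>a b c. A a b \<longrightarrow> A b c \<longrightarrow> a \<noteq> c \<longrightarrow> v \<in> {a, b, c}) \<or>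
    closed {v, x, y, z, x', y'} \<and>
    (\<forall>p q. p \<in> {v, x, y, z, x', y'} \<longrightarrow> A p q \<longrightarrow>
      {p, q} \<in> {{v, x}, {x, y}, {v, y}, {v, z}, {x, x'}, {y, y'}})"
proof -
  note S = s[unfolded spider_def]
  have v': "\<And>u. A v u \<Longrightarrow> u \<in> {y, x, z}" using v by blast
  note nx = spider_knee[OF s] and ny = spider_knee[OF spider_swap[OF s]]
  note nx' = spider_foot[OF s v] and ny' = spider_foot[OF spider_swap[OF s] v']
  show ?thesis
  proof (cases "\<exists>w. A z w \<and> w \<noteq> v")
    case False
    then have nz: "A z w \<Longrightarrow> w = v" for w by blast
    have *: "q \<in> {v, x, y, z, x', y'} \<and> {p, q} \<in> {{v, x}, {x, y}, {v, y}, {v, z}, {x, x'}, {y, y'}}"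
      if "p \<in> {v, x, y, z, x', y'}" "A p q" for p q
    proof -
      consider "p = v" | "p = x" | "p = y" | "p = z" | "p = x'" | "p = y'" using \<open>p \<in> _\<close> by blast
      then show ?thesis
      proof cases
        case 1 then show ?thesis using v[of q] that by auto
      next
        case 2 then show ?thesis using nx[of q] that by auto
      next
        case 3 then show ?thesis using ny[of q] that by auto
      next
        case 4 then show ?thesis using nz[of q] that by auto
      next
        case 5 then show ?thesis using nx'[of q] that by auto
      next
        case 6 then show ?thesis using ny'[of q] that by auto
      qed
    qed
    have "closed {v, x, y, z, x', y'}"
      unfolding closed_def using *[THEN conjunct1] by (intro ballI allI impI)
    then show ?thesis using *[THEN conjunct2] by (intro disjI2 conjI allI impI)
  next
    case True
    then obtain w where w: "A z w" "w \<noteq> v" by blast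
    have wz: "A w z" using w sym by blast
    have zn: "z \<notin> {v, x, y, x', y'}" using S by simp blast
    have "w \<noteq> x" using wz nx[of z] zn by blast
    moreover have "w \<noteq> y" using wz ny[of z] zn by blast
    moreover have "w \<noteq> x'" using wz nx'[of z] zn by blast
    moreover have "w \<noteq> y'" using wz ny'[of z] zn by blast
    moreover have "w \<noteq> z" using w neq by blast
    ultimately have d: "distinct [v, x, x', y, y', z, w]" using S w(2) by simp
    \<comment> \<open>By symmetry of the three long legs, \<open>z\<close> becomes a knee in two
      ways; intersecting the two conclusions of \<open>spider_knee\<close> leaves only
      \<open>v\<close> and \<open>w\<close> as its neighbours.\<close>
    have s2: "spider v z w x x' y" and s3: "spider v z w y y' x"
      using S d w by (auto simp: spider_def)
    have v2: "\<And>u. A v u \<Longrightarrow> u \<in> {z, x, y}" using v by blast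
    have nz: "A z u \<Longrightarrow> u \<in> {v, w}" for u
      using spider_knee[OF s2, of u] spider_knee[OF s3, of u] d by auto
    have nw: "A w u \<Longrightarrow> u = z" for u using spider_foot[OF s2 v2, of u] by blast
    have "\<not> A x y"
    proof
      assume "A x y"
      moreover have "distinct [x', x, y, v, z, w]" using d by auto
      ultimately show False using no_two_P3[of x' x y v z w] S w sym by blast
    qed
    then have nx2: "A x u \<Longrightarrow> u \<in> {v, x'}" and ny2: "A y u \<Longrightarrow> u \<in> {v, y'}" for u
      using nx[of u] ny[of u] sym by auto
    \<comment> \<open>Without \<open>v\<close> the legs are isolated edges, so the middle of a
      \<open>P_3\<close> avoiding \<open>v\<close> lies off them. Such a path then misses
      \<open>x\<close>, \<open>v\<close>, \<open>y\<close>, which is a second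
      \<open>P_3\<close>.\<close>
    have "v \<in> {a, b, c}" if P: "A a b" "A b c" "a \<noteq> c" for a b c
    proof (rule ccontr)
      assume n: "v \<notin> {a, b, c}"
      have ba: "A b a" using P sym by blast
      have "b \<notin> {x, y, z, x', y', w}"
        using n P ba nx2[of a] nx2[of c] ny2[of a] ny2[of c] nz[of a] nz[of c] nx'[of a] nx'[of c]
          ny'[of a] ny'[of c] nw[of a] nw[of c] by auto
      moreover from this have "a \<notin> {x, y}" "c \<notin> {x, y}"
        using n P nx2[of b] ny2[of b] sym[of b c] by auto
      ultimately have "distinct [x, v, y, a, b, c]" using n d P neq by auto
      then show False using no_two_P3[of x v y a b c] P S sym by blast
    qed
    then show ?thesis by (intro disjI1 allI impI)
  qed
qed

text \<open>
  Grow a \<open>P\<^sub>3\<close> one vertex at a time: every tree on six vertices of maximum degree at most 3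
  other than the spider with legs 2, 2, 1 contains two disjoint \<open>P\<^sub>3\<close>.
\<close>

lemma spider_exists:
  assumes deg: "\<And>v. card {u. A v u} \<le> 3" and fin: "\<And>v. finite {u. A v u}"
    and nc: "\<And>C. {a, b, c} \<subseteq> C \<Longrightarrow> finite C \<Longrightarrow> card C \<le> 5 \<Longrightarrow> \<not> closed C"
    and P: "A a b" "A b c" "a \<noteq> c"
  shows "\<exists>v x x' y y' z. spider v x x' y y' z"
proof -
  have leave: "\<exists>p\<in>C. \<exists>q. q \<notin> C \<and> A p q" if "{a, b, c} \<subseteq> C" "finite C" "card C \<le> 5" for C
    using nc[OF that] by (auto simp: closed_def)
  have nbrs: "\<not> (A v p \<and> A v q \<and> A v r \<and> A v t)" if "distinct [p, q, r, t]" for v p q r t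
  proof
    assume "A v p \<and> A v q \<and> A v r \<and> A v t"
    then have "card {p, q, r, t} \<le> card {u. A v u}" by (intro card_mono fin) auto
    then show False using that deg[of v] by simp
  qed
  \<comment> \<open>The tree with legs 2, 1, 1. A new vertex at \<open>y\<close> or \<open>z\<close>
    completes the spider, at \<open>x\<close> or \<open>x'\<close> it creates two disjoint paths,
    and at \<open>v\<close> it violates the degree bound.\<close>
  have chair: "\<exists>v x x' y y' z. spider v x x' y y' z"
    if d: "distinct [v, x, x', y, z]" and E: "A v x" "A x x'" "A v y" "A v z"
      and C: "{a, b, c} \<subseteq> {v, x, x', y, z}" for v x x' y z
  proof -
    obtain p q where pq: "p \<in> {v, x, x', y, z}" "q \<notin> {v, x, x', y, z}" "A p q"
      using leave[OF C] d by auto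
    have d6: "distinct [v, x, x', y, z, q]" using d pq by auto
    have R: "A x' x" "A y v" "A z v" "A q p" using E pq sym by auto
    consider "p = v" | "p = x" | "p = x'" | "p = y" | "p = z" using pq(1) by blast
    then show ?thesis
    proof cases
      case 1 then show ?thesis using nbrs[of x y z q v] E pq d6 by auto
    next
      case 2
      have "distinct [x', x, q, y, v, z]" using d6 by auto
      then show ?thesis using no_two_P3[of x' x q y v z] E pq R 2 by blast
    next
      case 3
      have "distinct [x, x', q, y, v, z]" using d6 by auto
      then show ?thesis using no_two_P3[of x x' q y v z] E pq R 3 by blast
    next
      case 4
      then have "spider v x x' y q z" using d6 E pq by (auto simp: spider_def)
      then show ?thesis by blast
    next
      case 5
      then have "spider v x x' z q y" using d6 E pq by (auto simp: spider_def)
      then show ?thesis by blast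
    qed
  qed
  \<comment> \<open>Only attachment at the middle vertex avoids two disjoint paths, and it yields
    the spider.\<close>
  have path5: "\<exists>v x x' y y' z. spider v x x' y y' z"
    if d: "distinct [p1, p2, p3, p4, p5]" and E: "A p1 p2" "A p2 p3" "A p3 p4" "A p4 p5"
      and C: "{a, b, c} \<subseteq> {p1, p2, p3, p4, p5}" for p1 p2 p3 p4 p5
  proof -
    obtain p q where pq: "p \<in> {p1, p2, p3, p4, p5}" "q \<notin> {p1, p2, p3, p4, p5}" "A p q"
      using leave[OF C] d by auto
    have d6: "distinct [p1, p2, p3, p4, p5, q]" using d pq by auto
    have R: "A p2 p1" "A p3 p2" "A p4 p3" "A p5 p4" "A q p" using E pq sym by auto
    consider "p = p1" | "p = p2" | "p = p3" | "p = p4" | "p = p5" using pq(1) by blast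
    then show ?thesis
    proof cases
      case 1
      have "distinct [q, p1, p2, p3, p4, p5]" using d6 by auto
      then show ?thesis using no_two_P3[of q p1 p2 p3 p4 p5] E pq R 1 by blast
    next
      case 2
      have "distinct [q, p2, p1, p3, p4, p5]" using d6 by auto
      then show ?thesis using no_two_P3[of q p2 p1 p3 p4 p5] E pq R 2 by blast
    next
      case 3
      then have "spider p3 p2 p1 p4 p5 q" using d6 E pq R by (auto simp: spider_def)
      then show ?thesis by blast
    next
      case 4
      have "distinct [p1, p2, p3, q, p4, p5]" using d6 by auto
      then show ?thesis using no_two_P3[of p1 p2 p3 q p4 p5] E pq R 4 by blast
    next
      case 5
      have "distinct [p1, p2, p3, p4, p5, q]" using d6 by auto
      then show ?thesis using no_two_P3[of p1 p2 p3 p4 p5 q] E pq R 5 by blast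
    qed
  qed
  \<comment> \<open>Attachment at an end leads to \<open>path5\<close>, at an inner vertex to
    \<open>chair\<close>.\<close>
  have path4: "\<exists>v x x' y y' z. spider v x x' y y' z"
    if d: "distinct [p1, p2, p3, p4]" and E: "A p1 p2" "A p2 p3" "A p3 p4"
      and C: "{a, b, c} \<subseteq> {p1, p2, p3, p4}" for p1 p2 p3 p4
  proof -
    obtain p q where pq: "p \<in> {p1, p2, p3, p4}" "q \<notin> {p1, p2, p3, p4}" "A p q"
      using leave[OF C] d by auto
    have d5: "distinct [p1, p2, p3, p4, q]" using d pq by auto
    have R: "A p2 p1" "A p3 p2" "A p4 p3" "A q p" using E pq sym by auto
    consider "p = p1" | "p = p2" | "p = p3" | "p = p4" using pq(1) by blast
    then show ?thesis
    proof cases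
      case 1 show ?thesis by (rule path5[of q p1 p2 p3 p4]) (use d5 E R C pq 1 in auto)
    next
      case 2 show ?thesis by (rule chair[of p2 p3 p4 p1 q]) (use d5 E R C pq 2 in auto)
    next
      case 3 show ?thesis by (rule chair[of p3 p2 p1 p4 q]) (use d5 E R C pq 3 in auto)
    next
      case 4 show ?thesis by (rule path5[of p1 p2 p3 p4 q]) (use d5 E R C pq 4 in auto)
    qed
  qed
  have star: "\<exists>v x x' y y' z. spider v x x' y y' z"
    if d: "distinct [v, x, y, z]" and E: "A v x" "A v y" "A v z"
      and C: "{a, b, c} \<subseteq> {v, x, y, z}" for v x y z
  proof -
    obtain p q where pq: "p \<in> {v, x, y, z}" "q \<notin> {v, x, y, z}" "A p q"
      using leave[OF C] d by auto
    have d5: "distinct [v, x, y, z, q]" using d pq by auto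
    consider "p = v" | "p = x" | "p = y" | "p = z" using pq(1) by blast
    then show ?thesis
    proof cases
      case 1 then show ?thesis using nbrs[of x y z q v] E pq d5 by auto
    next
      case 2 show ?thesis by (rule chair[of v x q y z]) (use d5 E C pq 2 in auto)
    next
      case 3 show ?thesis by (rule chair[of v y q x z]) (use d5 E C pq 3 in auto)
    next
      case 4 show ?thesis by (rule chair[of v z q x y]) (use d5 E C pq 4 in auto)
    qed
  qed
  have d: "distinct [a, b, c]" using P neq by auto
  obtain p q where pq: "p \<in> {a, b, c}" "q \<notin> {a, b, c}" "A p q"
    using leave[of "{a, b, c}"] d by auto
  have R: "A b a" "A c b" "A q p" using P pq sym by auto
  consider "p = a" | "p = b" | "p = c" using pq(1) by blast
  then show ?thesis
  proof cases
    case 1 show ?thesis by (rule path4[of q a b c]) (use d P R pq 1 in auto)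
  next
    case 2 show ?thesis by (rule star[of b a c q]) (use d P R pq 2 in auto)
  next
    case 3 show ?thesis by (rule path4[of a b c q]) (use d P R pq 3 in auto)
  qed
qed

text \<open>Degree at least 5 forces an apex; degree 4 forces an apex or a closed set of order 5.
  With all degrees at most 3, some \<open>P_3\<close> either lies in a closed set of order at most 5
  or grows into a spider, to which \<open>spider_structure\<close> applies.\<close>

theorem P3_structure:
  assumes V: "finite V" "card V \<ge> 4" and AV: "\<And>x y. A x y \<Longrightarrow> y \<in> V"
  obtains
    (apex) v where "v \<in> V" "\<And>a b c. A a b \<Longrightarrow> A b c \<Longrightarrow> a \<noteq> c \<Longrightarrow> v \<in> {a, b, c}"
  | (small) C where "C \<subseteq> V" "4 \<le> card C" "card C \<le> 5" "closed C"
      "\<And>a b c. {a, b, c} \<inter> C = {} \<Longrightarrow> A a b \<Longrightarrow> A b c \<Longrightarrow> a = c"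
  | (net) v x x' y y' z where "spider v x x' y y' z" "closed {v, x, y, z, x', y'}"
      "\<And>p q. p \<in> {v, x, y, z, x', y'} \<Longrightarrow> A p q \<Longrightarrow>
        {p, q} \<in> {{v, x}, {x, y}, {v, y}, {v, z}, {x, x'}, {y, y'}}"
      "\<And>a b c. {a, b, c} \<inter> {v, x, y, z, x', y'} = {} \<Longrightarrow> A a b \<Longrightarrow> A b c \<Longrightarrow> a = c"
proof -
  have AV': "\<And>x y. A x y \<Longrightarrow> x \<in> V" using AV sym by blast
  have fin: "finite {u. A v u}" for v using V(1) AV by (auto intro: finite_subset)
  obtain v0 where v0: "v0 \<in> V" using V by fastforce
  consider (none) "\<And>a b c. A a b \<Longrightarrow> A b c \<Longrightarrow> a = c"
    | (ge5) v where "card {u. A v u} \<ge> 5"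
    | (eq4) v a b c where "card {u. A v u} = 4" "A a b" "A b c" "a \<noteq> c" "v \<notin> {a, b, c}"
    | (eq4') v where "card {u. A v u} = 4" "\<And>a b c. A a b \<Longrightarrow> A b c \<Longrightarrow> a \<noteq> c \<Longrightarrow> v \<in> {a, b, c}"
    | (closed) a b c C where "A a b" "A b c" "a \<noteq> c" "{a, b, c} \<subseteq> C" "finite C" "card C \<le> 5" "closed C"
    | (large) a b c where "A a b" "A b c" "a \<noteq> c" "\<And>v. card {u. A v u} \<le> 3"
        "\<And>C. {a, b, c} \<subseteq> C \<Longrightarrow> finite C \<Longrightarrow> card C \<le> 5 \<Longrightarrow> \<not> closed C"
  proof -
    have "n \<ge> 5 \<or> n = 4 \<or> n \<le> 3" for n :: nat by auto
    then show ?thesis using that by metis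
  qed
  then show thesis
  proof cases
    \<comment> \<open>With no \<open>P_3\<close> at all, every vertex is vacuously an apex.\<close>
    case none then show ?thesis using apex[OF v0] by blast
  next
    case ge5
    then have "{u. A v u} \<noteq> {}" by (intro notI) simp
    then have "v \<in> V" using AV' by blast
    then show ?thesis using apex degree_ge_5[OF ge5] by blast
  next
    case eq4
    note D = degree_eq_4[OF eq4]
    have "v \<in> V" using D(2) AV' by blast
    then have sub: "insert v {u. A v u} \<subseteq> V" using AV by blast
    have card: "card (insert v {u. A v u}) = 5" using eq4 fin irr by simp
    have m: "p = r" if "{p, q, r} \<inter> insert v {u. A v u} = {}" "A p q" "A q r" for p q r
      using matching_outside[OF eq4(2,3,4) _ that] D(2) by (simp add: subset_insertI2)
    show ?thesis
    proof (rule small[OF sub _ _ D(1)])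
      show "4 \<le> card (insert v {u. A v u})" "card (insert v {u. A v u}) \<le> 5"
        unfolding card by simp_all
    qed (rule m)
  next
    case eq4'
    then have "{u. A v u} \<noteq> {}" by (intro notI) simp
    then have "v \<in> V" using AV' by blast
    then show ?thesis using apex eq4' by blast
  next
    case (closed a b c C)
    \<comment> \<open>\<open>C\<close> may contain points outside \<open>V\<close>; all adjacencies
      live in \<open>V\<close>, so the intersection stays closed.\<close>
    define B where "B = C \<inter> V"
    have B: "{a, b, c} \<subseteq> B" "finite B" "B \<subseteq> V" "closed B"
      using closed AV AV' by (auto simp: B_def closed_def)
    have "card B \<le> 5" using closed(5,6) unfolding B_def by (meson card_mono inf_le1 le_trans)
    note out = matching_outside[OF closed(1,2,3)]
    have "card {a, b, c} = 3" using closed neq by auto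
    then have "card B \<ge> 3" using B by (metis card_mono)
    then consider "card B \<ge> 4" | "card B = 3" by linarith
    then show ?thesis
    proof cases
      case 1
      then show ?thesis using small[of B] B \<open>card B \<le> 5\<close> out[OF B(1)] by blast
    next
      case 2
      \<comment> \<open>Pad a triangle or \<open>P\<^sub>3\<close> component by an edge if there is one, else by an isolated vertex,
        so that the order becomes 4 or 5 and no edge is cut.\<close>
      show ?thesis
      proof (cases "\<exists>p q. p \<notin> B \<and> A p q")
        case False
        have "\<not> V \<subseteq> B" using 2 V B card_mono[of B V] by linarith
        then obtain p where p: "p \<in> V" "p \<notin> B" by blast
        show ?thesis
        proof (rule small)
          show "insert p B \<subseteq> V" "4 \<le> card (insert p B)" "card (insert p B) \<le> 5"
            using p B 2 by auto
          show "closed (insert p B)" using False B p by (auto simp: closed_def)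
          show "\<And>a b c. {a, b, c} \<inter> insert p B = {} \<Longrightarrow> A a b \<Longrightarrow> A b c \<Longrightarrow> a = c"
            using False by blast
        qed
      next
        case True
        then obtain p q where pq: "p \<notin> B" "A p q" by blast
        have qB: "q \<notin> B" using pq B sym by (auto simp: closed_def)
        have nb: "A x y \<Longrightarrow> x \<notin> B \<Longrightarrow> y \<notin> B" for x y using B sym by (auto simp: closed_def)
        show ?thesis
        proof (rule small)
          show "insert p (insert q B) \<subseteq> V" "4 \<le> card (insert p (insert q B))"
            "card (insert p (insert q B)) \<le> 5"
            using pq qB B 2 AV AV' neq by auto
          \<comment> \<open>Outside \<open>B\<close> the graph is a matching, so the added edge is a
            component of its own.\<close>
          have "A p y \<Longrightarrow> y = q" for y using out[OF B(1), of q p y] pq qB nb sym by blast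
          moreover have "A q y \<Longrightarrow> y = p" for y using out[OF B(1), of p q y] pq qB nb by blast
          ultimately show "closed (insert p (insert q B))" using B by (auto simp: closed_def)
          show "\<And>a b c. {a, b, c} \<inter> insert p (insert q B) = {} \<Longrightarrow> A a b \<Longrightarrow> A b c \<Longrightarrow> a = c"
            using out[OF B(1)] by blast
        qed
      qed
    qed
  next
    case (large a b c)
    obtain v x x' y y' z where s: "spider v x x' y y' z"
      using spider_exists[OF large(4) fin large(5) large(1-3)] by blast
    note S = s[unfolded spider_def]
    have "{x, y, z} = {u. A v u}"
      by (rule card_seteq[OF fin]) (use S large(4)[of v] in auto)
    then have v: "A v u \<Longrightarrow> u \<in> {x, y, z}" for u by blast
    from spider_structure[OF s v] show ?thesis
    proof
      assume "\<forall>a b c. A a b \<longrightarrow> A b c \<longrightarrow> a \<noteq> c \<longrightarrow> v \<in> {a, b, c}"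
      then show ?thesis using apex[of v] AV' S by blast
    next
      assume *: "closed {v, x, y, z, x', y'} \<and>
        (\<forall>p q. p \<in> {v, x, y, z, x', y'} \<longrightarrow> A p q \<longrightarrow>
          {p, q} \<in> {{v, x}, {x, y}, {v, y}, {v, z}, {x, x'}, {y, y'}})"
      have "p = r" if "{p, q, r} \<inter> {v, x, y, z, x', y'} = {}" "A p q" "A q r" for p q r
        by (rule matching_outside[OF _ _ _ _ that, of x v y]) (use S sym[of v x] in auto)
      then show ?thesis using net[OF s] * by metis
    qed
  qed
qed

end

section \<open>Deleting vertices of large degree\<close>

lemma card_filter_split:
  assumes "finite X"
  shows "card X = card {x \<in> X. P x} + card {x \<in> X. \<not> P x}"
proof -
  have "X = {x \<in> X. P x} \<union> {x \<in> X. \<not> P x}" by blast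
  then show ?thesis using assms
    by (metis (no_types, lifting) card_Un_disjoint disjoint_iff finite_Un mem_Collect_eq)
qed

lemma card_matching:
  assumes "finite V" and E: "\<And>e. e \<in> E \<Longrightarrow> e \<subseteq> V \<and> card e = 2"
    and m: "\<And>a b c. {a, b} \<in> E \<Longrightarrow> {b, c} \<in> E \<Longrightarrow> a = c"
  shows "2 * card E \<le> card V"
proof -
  have fin: "finite E" using assms(1) E by (meson Pow_iff finite_Pow_iff finite_subset subsetI)
  have "pairwise disjnt E"
  proof (rule pairwiseI)
    fix e f assume ef: "e \<in> E" "f \<in> E" "e \<noteq> f"
    show "disjnt e f"
    proof (rule ccontr)
      assume "\<not> disjnt e f"
      then obtain b where b: "b \<in> e" "b \<in> f" by (auto simp: disjnt_def)
      obtain a where "e = {a, b}" using E[OF ef(1)] b by (auto simp: card_2_iff)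
      moreover obtain c where "f = {b, c}" using E[OF ef(2)] b by (auto simp: card_2_iff)
      ultimately show False using m[of a b c] ef by (auto simp: insert_commute)
    qed
  qed
  moreover have "\<And>e. e \<in> E \<Longrightarrow> finite e" using E by (meson assms(1) finite_subset)
  ultimately have "card (\<Union> E) = (\<Sum>e\<in>E. card e)" by (intro card_Union_disjoint)
  also have "\<dots> = 2 * card E" using E by simp
  finally have "2 * card E = card (\<Union> E)" by simp
  also have "\<dots> \<le> card V" using E assms(1) by (intro card_mono) auto
  finally show ?thesis .
qed

text \<open>At most \<open>3 * m\<close> edges at \<open>v\<close> have their other end in
  \<open>U\<close>. The remaining two or more supply a path with middle vertex
  \<open>v\<close>.\<close>

lemma P3_packing_add_vertex:
  assumes E: "\<And>e. e \<in> E \<Longrightarrow> card e = 2"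
    and deg: "card {e \<in> E. v \<in> e} \<ge> 3 * m + 2"
    and U: "P3_packing {e \<in> E. v \<notin> e} m U"
  shows "\<exists>U'. P3_packing E (Suc m) U'"
proof -
  let ?D = "{e \<in> E. v \<in> e}"
  have vU: "v \<notin> U" using P3_packing_subset[OF U] by auto
  have cU: "finite U" "card U = 3 * m" using P3_packing_card[OF U] by auto
  have fin: "finite ?D" using deg by (intro card_ge_0_finite) simp
  have "{e \<in> ?D. e \<inter> U \<noteq> {}} \<subseteq> (\<lambda>u. {v, u}) ` U"
  proof
    fix e assume e: "e \<in> {e \<in> ?D. e \<inter> U \<noteq> {}}"
    then obtain u where u: "u \<in> e" "u \<in> U" by blast
    have "card e = 2" "v \<in> e" "v \<noteq> u" using e E u vU by auto
    then have "e = {v, u}" using u by (auto simp: card_2_iff)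
    then show "e \<in> (\<lambda>u. {v, u}) ` U" using u by blast
  qed
  then have "card {e \<in> ?D. e \<inter> U \<noteq> {}} \<le> card ((\<lambda>u. {v, u}) ` U)"
    by (rule card_mono[OF finite_imageI[OF cU(1)]])
  also have "\<dots> \<le> 3 * m" using card_image_le[OF cU(1)] cU(2) by metis
  finally have "card {e \<in> ?D. e \<inter> U \<noteq> {}} \<le> 3 * m" .
  moreover have "card ?D = card {e \<in> ?D. e \<inter> U \<noteq> {}} + card {e \<in> ?D. e \<inter> U = {}}"
    using card_filter_split[OF fin, of "\<lambda>e. e \<inter> U \<noteq> {}"] by simp
  ultimately have "\<not> card {e \<in> ?D. e \<inter> U = {}} \<le> Suc 0" using deg by linarith
  then obtain e f where ef: "e \<in> ?D" "f \<in> ?D" "e \<inter> U = {}" "f \<inter> U = {}" "e \<noteq> f"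
    using card_le_Suc0_iff_eq[OF finite_subset[OF _ fin], of "{e \<in> ?D. e \<inter> U = {}}"] by blast
  obtain a where a: "e = {a, v}" "a \<noteq> v" using E[of e] ef by (auto simp: card_2_iff)
  obtain c where c: "f = {v, c}" "c \<noteq> v" using E[of f] ef by (auto simp: card_2_iff)
  have "P3_packing E m U" using U by (rule P3_packing_mono) auto
  then have "P3_packing E (Suc m) ({a, v, c} \<union> U)"
    by (rule P3_packing.add) (use a c ef in \<open>auto simp: insert_commute\<close>)
  then show ?thesis by blast
qed

text \<open>A packing that cannot be extended covers at most \<open>3 * m\<close> vertices, and the
  edges avoiding it form a matching. If all degrees were at most \<open>d\<close>, there would be at
  most \<open>3 * m * d\<close> edges meeting it and half of \<open>card V\<close> avoiding
  it.\<close>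

lemma high_degree_vertex:
  assumes V: "finite V" and E: "\<And>e. e \<in> E \<Longrightarrow> e \<subseteq> V \<and> card e = 2"
    and no: "\<not> (\<exists>U. P3_packing E (Suc m) U)"
    and large: "2 * card E > 6 * m * d + card V"
  shows "\<exists>v\<in>V. card {e \<in> E. v \<in> e} > d"
proof (rule ccontr)
  assume "\<not> ?thesis"
  then have deg: "card {e \<in> E. v \<in> e} \<le> d" if "v \<in> V" for v using that by force
  have fin: "finite E" using V E by (meson Pow_iff finite_Pow_iff finite_subset subsetI)
  \<comment> \<open>The predecessor of the least impossible size is attained and cannot be exceeded
    by one.\<close>
  define t where "t = (LEAST t. \<not> (\<exists>U. P3_packing E t U))"
  have t: "\<not> (\<exists>U. P3_packing E t U)" "t \<le> Suc m"
    unfolding t_def using no by (rule LeastI, rule Least_le)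
  have "t \<noteq> 0" using t(1) P3_packing.empty by metis
  then obtain s where s: "t = Suc s" using not0_implies_Suc by blast
  obtain U where U: "P3_packing E s U"
    using not_less_Least[of s "\<lambda>t. \<not> (\<exists>U. P3_packing E t U)"] s unfolding t_def by auto
  have cU: "finite U" "card U = 3 * s" "U \<subseteq> V"
    using P3_packing_card[OF U] P3_packing_subset[OF U] E by auto
  have "2 * card {e \<in> E. e \<inter> U = {}} \<le> card V"
  proof (rule card_matching[OF V])
    fix a b c assume abc: "{a, b} \<in> {e \<in> E. e \<inter> U = {}}" "{b, c} \<in> {e \<in> E. e \<inter> U = {}}"
    show "a = c"
    proof (rule ccontr)
      assume "a \<noteq> c"
      moreover have "a \<noteq> b" "b \<noteq> c" using abc E[of "{a, b}"] E[of "{b, c}"] by auto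
      ultimately have "P3_packing E (Suc s) ({a, b, c} \<union> U)"
        by (intro P3_packing.add[OF U]) (use abc in auto)
      then show False using t s by blast
    qed
  qed (use E in auto)
  moreover have "card {e \<in> E. e \<inter> U \<noteq> {}} \<le> 3 * m * d"
  proof -
    have "{e \<in> E. e \<inter> U \<noteq> {}} = (\<Union>u\<in>U. {e \<in> E. u \<in> e})" by auto
    then have "card {e \<in> E. e \<inter> U \<noteq> {}} \<le> (\<Sum>u\<in>U. card {e \<in> E. u \<in> e})"
      using card_UN_le[OF cU(1)] by metis
    also have "\<dots> \<le> (\<Sum>u\<in>U. d)" using deg cU by (intro sum_mono) auto
    also have "\<dots> \<le> 3 * m * d" using cU s t by simp
    finally show ?thesis .
  qed
  moreover have "card E = card {e \<in> E. e \<inter> U \<noteq> {}} + card {e \<in> E. e \<inter> U = {}}"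
    using card_filter_split[OF fin, of "\<lambda>e. e \<inter> U \<noteq> {}"] by simp
  ultimately show False using large by linarith
qed

text \<open>The bounds are those of the theorem, doubled, with \<open>k = j + 2\<close>. Deleting a
  vertex of high degree removes at most \<open>card V - 1\<close> edges, while the coefficient of
  \<open>card V\<close> in the edge bound drops by 2, so the bounds survive.\<close>

lemma delete_to_two_P3_free:
  assumes "finite V" and "\<And>e. e \<in> E \<Longrightarrow> e \<subseteq> V \<and> card e = 2"
    and "\<not> (\<exists>U. P3_packing E (j + 2) U)"
    and "2 * card V \<ge> 11 * (j + 2)^2 + 4 * j + 5"
    and "2 * card E > (2 * j + 1) * card V"
  shows "\<exists>S\<subseteq>V. card S = j \<and> \<not> (\<exists>U. P3_packing {e \<in> E. e \<inter> S = {}} 2 U)"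
  using assms
proof (induction j arbitrary: V E)
  case 0
  then show ?case by (intro exI[of _ "{}"]) (simp add: numeral_2_eq_2)
next
  case (Suc j)
  note fin = \<open>finite V\<close> and E = Suc.prems(2) and no = Suc.prems(3)
  let ?n = "card V"
  have n: "2 * ?n \<ge> 11 * j^2 + 70 * j + 108"
    using Suc.prems(4) by (simp add: power2_eq_square algebra_simps)
  \<comment> \<open>The choice \<open>m = j + 2\<close>, \<open>d = 3 * j + 7\<close> makes a degree
    above \<open>d\<close> at least \<open>3 * m + 2\<close>, exactly what
    \<open>P3_packing_add_vertex\<close> asks for.\<close>
  have "6 * (j + 2) * (3 * j + 7) \<le> (j + 1) * (11 * j^2 + 70 * j + 108)"
    by (simp add: power2_eq_square algebra_simps)
  also have "\<dots> \<le> (j + 1) * (2 * ?n)" using n by (intro mult_left_mono) auto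
  also have "(j + 1) * (2 * ?n) + ?n = (2 * Suc j + 1) * ?n" by (simp add: algebra_simps)
  finally have "6 * (j + 2) * (3 * j + 7) + ?n \<le> (2 * Suc j + 1) * ?n" by simp
  then have "2 * card E > 6 * (j + 2) * (3 * j + 7) + ?n" using Suc.prems(5) by linarith
  then obtain v where v: "v \<in> V" and deg: "card {e \<in> E. v \<in> e} > 3 * j + 7"
    using high_degree_vertex[where E = E and m = "j + 2" and d = "3 * j + 7", OF fin E] no by auto
  let ?E = "{e \<in> E. v \<notin> e}"
  have finE: "finite E" using fin E by (meson Pow_iff finite_Pow_iff finite_subset subsetI)
  have cV: "card (V - {v}) = ?n - 1" "?n \<ge> 1" using v fin by (auto simp: card_gt_0_iff Suc_le_eq)
  have "card {e \<in> E. v \<in> e} \<le> card ((\<lambda>u. {v, u}) ` (V - {v}))"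
  proof (rule card_mono)
    show "{e \<in> E. v \<in> e} \<subseteq> (\<lambda>u. {v, u}) ` (V - {v})"
    proof
      fix e assume e: "e \<in> {e \<in> E. v \<in> e}"
      then obtain u where "e = {v, u}" "u \<noteq> v" using E[of e] by (auto simp: card_2_iff)
      then show "e \<in> (\<lambda>u. {v, u}) ` (V - {v})" using e E[of e] by auto
    qed
  qed (use fin in simp)
  also have "\<dots> \<le> ?n - 1" using card_image_le[of "V - {v}"] fin cV by simp
  finally have "card {e \<in> E. v \<in> e} \<le> ?n - 1" .
  moreover have "card E = card {e \<in> E. v \<in> e} + card ?E"
    by (rule card_filter_split[OF finE])
  ultimately have "2 * card E \<le> 2 * (?n - 1) + 2 * card ?E" by simp
  then have "2 * card ?E > (2 * j + 1) * card (V - {v})"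
    using Suc.prems(5) cV by (cases ?n) (auto simp: algebra_simps)
  moreover have "2 * card (V - {v}) \<ge> 11 * (j + 2)^2 + 4 * j + 5"
    using n cV by (simp add: power2_eq_square algebra_simps)
  moreover have "\<not> (\<exists>U. P3_packing ?E (j + 2) U)"
    using P3_packing_add_vertex[of E "j + 2" v] E deg no by auto
  ultimately obtain S where S: "S \<subseteq> V - {v}" "card S = j"
    "\<not> (\<exists>U. P3_packing {e \<in> ?E. e \<inter> S = {}} 2 U)"
    using Suc.IH[of "V - {v}" ?E] fin E by auto
  have "{e \<in> E. e \<inter> insert v S = {}} = {e \<in> ?E. e \<inter> S = {}}" by auto
  moreover have "card (insert v S) = Suc j" using S fin finite_subset[OF S(1)] by (subst card_insert_disjoint) auto
  ultimately show ?case using S v by (intro exI[of _ "insert v S"]) auto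
qed

section \<open>Assembling the exceptional graphs\<close>

lemma complete_graph_edge:
  assumes "bij_betw \<phi> C {..<h}" "u \<in> C" "v \<in> C" "u \<noteq> v"
  shows "{\<phi> u, \<phi> v} \<in> edges (complete_graph h)"
proof -
  have "\<phi> u \<noteq> \<phi> v" "\<phi> u < h" "\<phi> v < h"
    using assms by (auto simp: bij_betw_def inj_on_def)
  then show ?thesis by (auto simp: complete_graph_def)
qed

text \<open>Into a complete graph every bijection preserves edges, so any enumeration of
  \<open>C\<close> serves.\<close>

lemma contained_in_F_graph_complete:
  assumes G: "simple_graph G" and S: "S \<subseteq> verts G" and C: "C \<subseteq> verts G - S"
    and k: "k = card S + 1"
    and closed: "\<And>u w. u \<in> C \<Longrightarrow> {u, w} \<in> edges G \<Longrightarrow> w \<in> C \<union> S"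
    and matching: "\<And>a b c. {a, b, c} \<inter> (S \<union> C) = {} \<Longrightarrow> {a, b} \<in> edges G \<Longrightarrow>
      {b, c} \<in> edges G \<Longrightarrow> a = c"
  shows "G \<sqsubseteq>\<^sub>g F_graph (card (verts G)) k (complete_graph (card C))"
proof -
  have "finite C" using G C by (auto simp: simple_graph_def intro: finite_subset)
  then obtain \<phi> where \<phi>: "bij_betw \<phi> C {..<card C}"
    using ex_bij_betw_finite_nat by (metis atLeast0LessThan)
  have "{\<phi> u, \<phi> v} \<in> edges (complete_graph (card C))"
    if "u \<in> C" "v \<in> C" "{u, v} \<in> edges G" for u v
  proof (rule complete_graph_edge[OF \<phi> that(1,2)])
    show "u \<noteq> v" using that(3) G by (auto simp: simple_graph_def)
  qed
  moreover have "bij_betw \<phi> C (verts (complete_graph (card C)))"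
    using \<phi> by (simp add: complete_graph_def)
  ultimately show ?thesis using contained_in_F_graph[OF G S C k] closed matching by blast
qed

theorem theorem1p3:
  fixes G :: "'a ugraph" and k n :: nat
  assumes "k \<ge> 2"
    and "simple_graph G"
    and "card (verts G) = n"
    and "real n \<ge> 11 / 2 * (real k)\<^sup>2 + 2 * real k - 3 / 2"
    and "real (card (edges G)) > (real k - 3 / 2) * real n"
  shows "copies k (path_graph 3) \<sqsubseteq>\<^sub>g G \<or>
         G \<sqsubseteq>\<^sub>g F_graph n k (complete_graph 2) \<or>
         (\<exists>h. 4 \<le> h \<and> h \<le> 5 \<and> G \<sqsubseteq>\<^sub>g F_graph n (k - 1) (complete_graph h)) \<or>
         G \<sqsubseteq>\<^sub>g F_graph n (k - 1) N6"
proof (cases "\<exists>U. P3_packing (edges G) k U")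
  case True
  then show ?thesis using P3_packing_contained_in[OF assms(2)] by blast
next
  case False
  note G = assms(2) and n = assms(3)
  let ?V = "verts G" and ?E = "edges G"
  have fin: "finite ?V" and E: "\<And>e. e \<in> ?E \<Longrightarrow> e \<subseteq> ?V \<and> card e = 2"
    using G by (auto simp: simple_graph_def)
  define j where "j = k - 2"
  have k: "k = j + 2" using assms(1) by (simp add: j_def)
  have "real (2 * n) \<ge> real (11 * (j + 2)^2 + 4 * j + 5)"
    using assms(4) unfolding k by simp
  then have n1: "2 * card ?V \<ge> 11 * (j + 2)^2 + 4 * j + 5" unfolding n of_nat_le_iff .
  have "real (2 * card ?E) > real ((2 * j + 1) * n)"
    using assms(5) unfolding k by (simp add: algebra_simps)
  then have "2 * card ?E > (2 * j + 1) * card ?V" unfolding n of_nat_less_iff .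
  then obtain S where S: "S \<subseteq> ?V" "card S = j"
    and free: "\<not> (\<exists>U. P3_packing {e \<in> ?E. e \<inter> S = {}} 2 U)"
    using delete_to_two_P3_free[OF fin E _ n1] False k by auto
  \<comment> \<open>Adjacency in \<open>G\<close> after deleting the \<open>k - 2\<close> vertices
    of \<open>S\<close>.\<close>
  define A where "A x y \<longleftrightarrow> {x, y} \<in> {e \<in> ?E. e \<inter> S = {}}" for x y
  interpret two_P3_free A
  proof
    show "A x y \<Longrightarrow> A y x" for x y by (auto simp: A_def insert_commute)
    show "\<not> A x x" for x using E[of "{x}"] by (auto simp: A_def)
    show False if "distinct [a, b, c, d, e, f]" "A a b" "A b c" "A d e" "A e f" for a b c d e f
      using P3_packing_two[OF that(1) that(2-5)[unfolded A_def]] free by contradiction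
  qed
  have AI: "A x y" if "{x, y} \<in> ?E" "x \<notin> S" "y \<notin> S" for x y using that by (auto simp: A_def)
  have finS: "finite S" using S fin finite_subset by blast
  have cVS: "card (?V - S) = n - j" using S finS n by (simp add: card_Diff_subset)
  have "2 * n \<ge> 2 * j + 8" using n1 n by (simp add: power2_eq_square algebra_simps)
  then have big: "card (?V - S) \<ge> 4" using cVS by linarith
  have AV: "y \<in> ?V - S" if "A x y" for x y using that E[of "{x, y}"] by (auto simp: A_def)
  \<comment> \<open>The clique of \<open>F_graph n (k - 1) H\<close> has \<open>k - 2\<close>
    vertices, exactly enough for \<open>S\<close>; in the apex case \<open>v\<close> joins
    \<open>S\<close> and the index becomes \<open>k\<close>.\<close>
  have kS: "k - 1 = card S + 1" using k S by simp
  show ?thesis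
  proof (rule P3_structure[of "?V - S"])
    show "finite (?V - S)" using fin by simp
    show "4 \<le> card (?V - S)" by (rule big)
    show "\<And>x y. A x y \<Longrightarrow> y \<in> ?V - S" by (rule AV)
  next
    fix v assume v: "v \<in> ?V - S" and apex: "\<And>a b c. A a b \<Longrightarrow> A b c \<Longrightarrow> a \<noteq> c \<Longrightarrow> v \<in> {a, b, c}"
    let ?S = "insert v S" and ?R = "?V - insert v S"
    have m: "a = c" if "{a, b, c} \<inter> ?S = {}" "{a, b} \<in> ?E" "{b, c} \<in> ?E" for a b c
      using apex[of a b c] AI that by blast
    \<comment> \<open>The distinguished \<open>K_2\<close> must not cut an edge of the remaining
      matching: take a matching edge if there is one, otherwise any two remaining vertices.\<close>
    have "\<exists>C\<subseteq>?R. card C = 2 \<and> (\<forall>u w. u \<in> C \<longrightarrow> {u, w} \<in> ?E \<longrightarrow> w \<in> C \<union> ?S)"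
    proof (cases "\<exists>e\<in>?E. e \<inter> ?S = {}")
      case True
      then obtain e where e: "e \<in> ?E" "e \<inter> ?S = {}" by blast
      have "w \<in> e \<union> ?S" if u: "u \<in> e" "{u, w} \<in> ?E" for u w
      proof (rule ccontr)
        assume w: "w \<notin> e \<union> ?S"
        obtain t where t: "e = {t, u}" using E[OF e(1)] u by (auto simp: card_2_iff)
        have "t = w" by (rule m[of t u w]) (use t w e u in auto)
        then show False using t w by simp
      qed
      then show ?thesis using e E[OF e(1)] by (intro exI[of _ e]) auto
    next
      case False
      have "card (?V - S - {v}) = card (?V - S) - 1" using v fin by (simp add: card_Diff_singleton)
      moreover have "?R = ?V - S - {v}" by auto
      ultimately have "2 \<le> card ?R" using big by simp
      then obtain C where C: "C \<subseteq> ?R" "card C = 2" by (meson obtain_subset_with_card_n)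
      have "w \<in> C \<union> ?S" if "u \<in> C" "{u, w} \<in> ?E" for u w
        using False that C by auto
      then show ?thesis using C by blast
    qed
    then obtain C where C: "C \<subseteq> ?R" "card C = 2"
      "\<And>u w. u \<in> C \<Longrightarrow> {u, w} \<in> ?E \<Longrightarrow> w \<in> C \<union> ?S" by blast
    have "G \<sqsubseteq>\<^sub>g F_graph (card ?V) k (complete_graph (card C))"
    proof (rule contained_in_F_graph_complete[OF G _ C(1) _ C(3)])
      show "?S \<subseteq> ?V" using S(1) v by blast
      show "k = card ?S + 1" using v S k finS by simp
      show "a = c" if "{a, b, c} \<inter> (?S \<union> C) = {}" "{a, b} \<in> ?E" "{b, c} \<in> ?E" for a b c
        by (rule m[OF _ that(2,3)]) (use that(1) in blast)
    qed
    then show ?thesis using C n by simp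
  next
    fix C assume C: "C \<subseteq> ?V - S" "4 \<le> card C" "card C \<le> 5" "closed C"
      and m: "\<And>a b c. {a, b, c} \<inter> C = {} \<Longrightarrow> A a b \<Longrightarrow> A b c \<Longrightarrow> a = c"
    have "G \<sqsubseteq>\<^sub>g F_graph (card ?V) (k - 1) (complete_graph (card C))"
    proof (rule contained_in_F_graph_complete[OF G S(1) C(1) kS])
      show "w \<in> C \<union> S" if "u \<in> C" "{u, w} \<in> ?E" for u w
        using AI[OF that(2)] that C by (auto simp: closed_def)
      show "a = c" if "{a, b, c} \<inter> (S \<union> C) = {}" "{a, b} \<in> ?E" "{b, c} \<in> ?E" for a b c
        by (rule m[of a b c]) (use AI that in auto)
    qed
    then show ?thesis using C n by auto
  next
    fix v x x' y y' z
    assume s: "spider v x x' y y' z" and cl: "closed {v, x, y, z, x', y'}"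
      and net: "\<And>p q. p \<in> {v, x, y, z, x', y'} \<Longrightarrow> A p q \<Longrightarrow>
        {p, q} \<in> {{v, x}, {x, y}, {v, y}, {v, z}, {x, x'}, {y, y'}}"
      and m: "\<And>a b c. {a, b, c} \<inter> {v, x, y, z, x', y'} = {} \<Longrightarrow> A a b \<Longrightarrow> A b c \<Longrightarrow> a = c"
    define C where "C = {v, x, y, z, x', y'}"
    note sp = s[unfolded spider_def]
    have CV: "C \<subseteq> ?V - S"
      using sp AV[of v x] AV[of v y] AV[of v z] AV[of x x'] AV[of y y'] AV[OF sym, of v x]
      by (auto simp: C_def)
    \<comment> \<open>The numbering follows \<open>N6\<close>: the triangle 0, 1, 2 is
      \<open>v\<close>, \<open>x\<close>, \<open>y\<close>, and the pendant vertices 3, 4, 5 are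
      \<open>z\<close>, \<open>x'\<close>, \<open>y'\<close> in the same order.\<close>
    define \<phi> where "\<phi> p = (if p = v then 0 else if p = x then 1 else if p = y then 2
      else if p = z then 3 else if p = x' then 4 else 5 :: nat)" for p
    have \<phi>: "\<phi> v = 0" "\<phi> x = 1" "\<phi> y = 2" "\<phi> z = 3" "\<phi> x' = 4" "\<phi> y' = 5"
      using sp by (auto simp: \<phi>_def)
    have "\<phi> ` C = {..<6}" unfolding C_def by (auto simp: \<phi>)
    moreover have "inj_on \<phi> C" unfolding C_def inj_on_def by (simp add: \<phi>)
    ultimately have bij: "bij_betw \<phi> C (verts N6)" by (simp add: bij_betw_def N6_def)
    have "G \<sqsubseteq>\<^sub>g F_graph (card ?V) (k - 1) N6"
    proof (rule contained_in_F_graph[OF G S(1) CV kS bij])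
      show "w \<in> C \<union> S" if "u \<in> C" "{u, w} \<in> ?E" for u w
        using AI[OF that(2)] that CV cl by (auto simp: closed_def C_def[symmetric])
      show "a = c" if "{a, b, c} \<inter> (S \<union> C) = {}" "{a, b} \<in> ?E" "{b, c} \<in> ?E" for a b c
        by (rule m[of a b c]) (use AI that in \<open>auto simp: C_def\<close>)
      show "{\<phi> p, \<phi> q} \<in> edges N6" if "p \<in> C" "q \<in> C" "{p, q} \<in> ?E" for p q
      proof -
        have "A p q" using AI that CV by blast
        then have "{p, q} \<in> {{v, x}, {x, y}, {v, y}, {v, z}, {x, x'}, {y, y'}}"
          using net that(1) by (simp add: C_def)
        then have "\<phi> ` {p, q} \<in> (`) \<phi> ` {{v, x}, {x, y}, {v, y}, {v, z}, {x, x'}, {y, y'}}"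
          by (rule imageI)
        then show ?thesis by (simp add: \<phi> N6_def)
      qed
    qed
    then show ?thesis using n by simp
  qed
qed

end
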